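(* Let $\lambda<0$, $n=2$, $R>0$, and suppose $v_0(R)>0$. Then there exists $t_c\in(0,\infty)$ such that $X(t_c,R)=0$ or $\Gamma(t_c,R)=0$ if and only if $$v_0'(R)<\frac{A(R)}{2Rv_0(R)}$$ (which, when $\partial_rA(R)>0$, is equivalent to $\exp(-\partial_rC(R)/\partial_rA(R))>R$) and one of the following conditions holds: (1) $\rho_0(R)=0$ (i.e. $\partial_rA(R)=0$); (2) $\partial_rA(R)>0$ and $$\frac1{v_0(R)}+\frac12\int_R^{\exp\left(-\frac{\partial_rC(R)}{\partial_rA(R)}\right)}\frac{\partial_rC(R)+\partial_rA(R)\log y}{(C(R)+A(R)\log y)^{3/2}}dy\le0.$$
   Context: Data: $\rho_0\in C([0,\infty))$, $\rho_0\ge0$; $v_0\in C([0,\infty))\cap C^1((0,\infty))$ with $v_0(0)=0$. Put $m_0(r)=\int_0^r\rho_0(s)s\,ds$, $A(r)=2|\lambda|m_0(r)$, $C(r)=v_0(r)^2-A(r)\log r$. For each $R>0$, $X(t,R)$ (the characteristic curve of the two-dimensional radial Euler-Poisson system) is the solution of $$X''(t,R)=-\frac{\lambda m_0(R)}{X(t,R)},\quad X'(0,R)=v_0(R),\quad X(0,R)=R,$$ where primes on $X$ are $t$-derivatives, continued up to the first time (if any) at which $X$ reaches $0$; and $\Gamma(t,R)=\partial_RX(t,R)$. A necessary and sufficient condition for the existence of $t_c\in(0,\infty)$ with $X(t_c,R)=0$ or $\Gamma(t_c,R)=0$ is called a pointwise condition for finite-time breakdown (PCFB) at $R$. *)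

theory Defs
  imports "HOL-Analysis.Analysis"
begin

definition initial_mass :: "(real \<Rightarrow> real) \<Rightarrow> real \<Rightarrow> real" where
  "initial_mass \<rho>0 r = integral {0..r} (\<lambda>s. \<rho>0 s * s)"

definition A_fun :: "real \<Rightarrow> (real \<Rightarrow> real) \<Rightarrow> real \<Rightarrow> real" where
  "A_fun lam \<rho>0 r = 2 * \<bar>lam\<bar> * initial_mass \<rho>0 r"

definition C_fun :: "real \<Rightarrow> (real \<Rightarrow> real) \<Rightarrow> (real \<Rightarrow> real) \<Rightarrow> real \<Rightarrow> real" where
  "C_fun lam \<rho>0 v0 r = (v0 r)\<^sup>2 - A_fun lam \<rho>0 r * ln r"

definition admissible_data :: "(real \<Rightarrow> real) \<Rightarrow> (real \<Rightarrow> real) \<Rightarrow> bool" where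
  "admissible_data \<rho>0 v0 \<longleftrightarrow>
     continuous_on {0..} \<rho>0 \<and> (\<forall>r\<ge>0. 0 \<le> \<rho>0 r) \<and>
     continuous_on {0..} v0 \<and> v0 C1_differentiable_on {0<..} \<and> v0 0 = 0"

text \<open>The curve \<open>x\<close> is a total function, but only its values up to and including its first zero
  (if there is one) matter. The equation is imposed at every time up to which \<open>x\<close> has stayed
  positive; derivatives are relative to \<open>{0..}\<close>, hence one-sided at time 0 and ordinary
  afterwards. The continuity clause includes the first zero: without it a curve could jump to 0
  although the solution it is supposed to follow can be continued.\<close>

definition characteristic_curve ::
  "real \<Rightarrow> (real \<Rightarrow> real) \<Rightarrow> (real \<Rightarrow> real) \<Rightarrow> real \<Rightarrow> (real \<Rightarrow> real) \<Rightarrow> bool" where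
  "characteristic_curve lam \<rho>0 v0 R x \<longleftrightarrow>
     x 0 = R \<and>
     (\<forall>t\<ge>0. (\<forall>s\<in>{0..<t}. 0 < x s) \<longrightarrow> continuous_on {0..t} x) \<and>
     (\<exists>x'. x' 0 = v0 R \<and>
        (\<forall>t\<ge>0. (\<forall>s\<in>{0..t}. 0 < x s) \<longrightarrow>
           (x has_real_derivative x' t) (at t within {0..}) \<and>
           (x' has_real_derivative - (lam * initial_mass \<rho>0 R) / x t) (at t within {0..})))"

text \<open>\<open>X t R\<close> is the position at time \<open>t\<close> of the characteristic starting from \<open>R\<close>.\<close>

definition characteristic_flow ::
  "real \<Rightarrow> (real \<Rightarrow> real) \<Rightarrow> (real \<Rightarrow> real) \<Rightarrow> (real \<Rightarrow> real \<Rightarrow> real) \<Rightarrow> bool" where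
  "characteristic_flow lam \<rho>0 v0 X \<longleftrightarrow>
     (\<forall>R>0. characteristic_curve lam \<rho>0 v0 R (\<lambda>t. X t R))"

text \<open>The time \<open>t\<close> must not lie beyond the first zero of the curve from \<open>R\<close>. The condition that
  \<open>\<partial>X/\<partial>R\<close> vanishes is stated with \<open>has_real_derivative\<close>, so that it includes the existence of
  this derivative.\<close>

definition breakdown_at :: "(real \<Rightarrow> real \<Rightarrow> real) \<Rightarrow> real \<Rightarrow> real \<Rightarrow> bool" where
  "breakdown_at X R t \<longleftrightarrow>
     (\<forall>s\<in>{0..<t}. 0 < X s R) \<and>
     (X t R = 0 \<or> ((\<lambda>r. X t r) has_real_derivative 0) (at R))"

end

theory Submission
  imports Defs
begin

text \<open>Since \<open>\<lambda> < 0\<close> and \<open>v\<^sub>0(R) > 0\<close>, a characteristic never returns towards the origin, and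
  conservation of \<open>X'\<^sup>2 - A log X\<close> gives \<open>X' = (C + A log X)\<^bsup>1/2\<^esup>\<close>, that is
  \<open>t = \<integral> (C(R) + A(R) log y)\<^bsup>-1/2\<^esup> dy\<close> over \<open>[R, X]\<close>. Differentiating this identity in \<open>R\<close> yields
  \<open>\<Gamma> = X' G(X)\<close> with \<open>G(y) = 1/v\<^sub>0 + 1/2 \<integral> (C' + A' log z) / (C + A log z)\<^bsup>3/2\<^esup> dz\<close> over
  \<open>[R, y]\<close>. As \<open>X\<close> runs through all of \<open>[R, \<infinity>)\<close>, breakdown means that \<open>G\<close> has a zero, and the sign
  of \<open>C' + A' log z\<close> decides: nonnegative at \<open>R\<close>, it keeps \<open>G\<close> positive; a negative constant (the
  case \<open>A' = 0\<close>) drives \<open>G\<close> to \<open>-\<infinity>\<close>; otherwise \<open>G\<close> is minimal at \<open>exp (-C'/A')\<close>.\<close>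

section \<open>Sign and derivative of the initial mass\<close>

lemma initial_mass_nonneg:
  assumes "admissible_data \<rho>0 v0"
  shows "0 \<le> initial_mass \<rho>0 r"
proof -
  have "continuous_on {0..} \<rho>0" using assms by (simp add: admissible_data_def)
  then have "continuous_on {0..r} \<rho>0" by (rule continuous_on_subset) simp
  then have "continuous_on {0..r} (\<lambda>s. \<rho>0 s * s)" by (intro continuous_intros)
  then show ?thesis
    unfolding initial_mass_def using assms
    by (intro integral_nonneg) (auto simp: admissible_data_def intro: integrable_continuous_real)
qed

lemma initial_mass_has_derivative:
  assumes "admissible_data \<rho>0 v0" "r > 0"
  shows "(initial_mass \<rho>0 has_real_derivative \<rho>0 r * r) (at r)"
proof -
  have "continuous_on {0..} \<rho>0" using assms by (simp add: admissible_data_def)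
  \<comment> \<open>The right end \<open>r+1\<close> makes \<open>r\<close> an interior point, so
    the derivative of the integral within the interval is a two-sided one.\<close>
  then have "continuous_on {0..r+1} \<rho>0" by (rule continuous_on_subset) simp
  then have c: "continuous_on {0..r+1} (\<lambda>s. \<rho>0 s * s)" by (intro continuous_intros)
  have "((\<lambda>u. integral {0..u} (\<lambda>s. \<rho>0 s * s)) has_real_derivative \<rho>0 r * r) (at r within {0..r+1})"
    using integral_has_real_derivative[OF c, of r] assms by auto
  moreover have "at r within {0..r+1} = at r"
    using assms by (intro at_within_interior) auto
  ultimately show ?thesis
    unfolding initial_mass_def by simp
qed

section \<open>Global positivity and energy of a characteristic\<close>

text \<open>The equation is available only while the curve has stayed positive, so positivity is
  bootstrapped. As long as it holds, the acceleration is nonnegative, the speed stays at least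
  \<open>v0 R\<close>, and the curve lies above a rising line. A first nonpositive time would
  contradict this line, hence the equation holds for all nonnegative times.\<close>

lemma characteristic_curve_lower_bound:
  assumes cc: "characteristic_curve lam \<rho>0 v0 R x"
    and k: "lam * initial_mass \<rho>0 R \<le> 0" and R: "R > 0" and v: "v0 R > 0"
  obtains x' where "x' 0 = v0 R"
    "\<And>t. t \<ge> 0 \<Longrightarrow> R + v0 R * t \<le> x t"
    "\<And>t. t \<ge> 0 \<Longrightarrow> v0 R \<le> x' t"
    "\<And>t. t \<ge> 0 \<Longrightarrow> (x has_real_derivative x' t) (at t within {0..})"
    "\<And>t. t \<ge> 0 \<Longrightarrow> (x' has_real_derivative - (lam * initial_mass \<rho>0 R) / x t) (at t within {0..})"
proof -
  define k where "k = - (lam * initial_mass \<rho>0 R)"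
  have k0: "k \<ge> 0" using k by (simp add: k_def)
  have x0: "x 0 = R" and cont: "\<And>t. t \<ge> 0 \<Longrightarrow> (\<And>s. s \<in> {0..<t} \<Longrightarrow> 0 < x s) \<Longrightarrow> continuous_on {0..t} x"
    using cc unfolding characteristic_curve_def by blast+
  obtain x' where x'0: "x' 0 = v0 R" and
    D: "\<And>t. t \<ge> 0 \<Longrightarrow> (\<And>s. s \<in> {0..t} \<Longrightarrow> 0 < x s) \<Longrightarrow>
           (x has_real_derivative x' t) (at t within {0..}) \<and>
           (x' has_real_derivative k / x t) (at t within {0..})"
    using cc unfolding characteristic_curve_def k_def by blast
  have at: "at t within {0..} = at t" if "t > 0" for t :: real
    using that by (intro at_within_interior) auto
  have v_le: "v0 R \<le> x' t" if t: "t \<ge> 0" and p: "\<And>s. s \<in> {0..t} \<Longrightarrow> 0 < x s" for t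
  proof -
    have "x' 0 \<le> x' t"
    proof (rule DERIV_nonneg_imp_increasing_open[OF t])
      fix s assume s: "0 < s" "s < t"
      show "\<exists>y. (x' has_real_derivative y) (at s) \<and> 0 \<le> y"
        using D[of s] p s at[of s] k0 by (intro exI[of _ "k / x s"]) (auto simp: less_imp_le)
    next
      show "continuous_on {0..t} x'"
        unfolding continuous_on_eq_continuous_within
      proof
        fix s assume "s \<in> {0..t}"
        then have "(x' has_real_derivative k / x s) (at s within {0..})"
          using D[of s] p by auto
        then have "continuous (at s within {0..}) x'" by (rule DERIV_continuous)
        then show "continuous (at s within {0..t}) x'"
          by (rule continuous_within_subset) auto
      qed
    qed
    then show ?thesis by (simp add: x'0)
  qed
  \<comment> \<open>Positivity is assumed only before \<open>t\<close>: derivatives are used on the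
    open interval, and continuity carries the bound to \<open>t\<close> itself. The bound thus
    applies at a potential first zero.\<close>
  have lower: "R + v0 R * t \<le> x t" if t: "t \<ge> 0" and p: "\<And>s. s \<in> {0..<t} \<Longrightarrow> 0 < x s" for t
  proof -
    have "x 0 - v0 R * 0 \<le> x t - v0 R * t"
    proof (rule DERIV_nonneg_imp_increasing_open[OF t])
      fix s assume s: "0 < s" "s < t"
      have "(x has_real_derivative x' s) (at s)" "v0 R \<le> x' s"
        using D[of s] v_le[of s] p s at[of s] by auto
      then show "\<exists>y. ((\<lambda>a. x a - v0 R * a) has_real_derivative y) (at s) \<and> 0 \<le> y"
        by (intro exI[of _ "x' s - v0 R"]) (auto intro!: derivative_eq_intros)
    next
      show "continuous_on {0..t} (\<lambda>a. x a - v0 R * a)"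
        using cont[OF t p] by (intro continuous_intros) auto
    qed
    then show ?thesis by (simp add: x0)
  qed
  have pos: "x t > 0" if t: "t \<ge> 0" for t
  proof (rule ccontr)
    assume "\<not> x t > 0"
    define S where "S = {t. t \<ge> 0 \<and> x t \<le> 0}"
    have S: "S \<noteq> {}" "bdd_below S"
      using t \<open>\<not> x t > 0\<close> by (auto simp: S_def intro!: bdd_belowI[of _ 0])
    \<comment> \<open>The curve is positive before \<open>u\<close>, so the linear bound makes it
      positive at \<open>u\<close> too. Continuity then extends positivity to a distance
      \<open>d\<close> beyond \<open>u\<close>, which contradicts the choice of \<open>u\<close> as
      infimum of the nonpositive times.\<close>
    define u where "u = Inf S"
    have u0: "u \<ge> 0" unfolding u_def using S by (intro cInf_greatest) (auto simp: S_def)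
    have before: "x s > 0" if "s \<in> {0..<u}" for s
      using that cInf_lower[OF _ S(2), of s] unfolding u_def S_def by force
    have "R + v0 R * u \<le> x u" using lower[OF u0 before] .
    then have xu: "x u > 0" using R v u0 by (smt (verit) mult_nonneg_nonneg)
    have "x s > 0" if "s \<in> {0..u}" for s
      using before[of s] xu that by (cases "s = u") auto
    then have "(x has_real_derivative x' u) (at u within {0..})"
      using D[OF u0] by blast
    then have "continuous (at u within {0..}) x" by (rule DERIV_continuous)
    then have "\<forall>\<^sub>F s in at u within {0..}. 0 < x s"
      using xu unfolding continuous_within by (rule order_tendstoD)
    then obtain d where d: "d > 0" "\<And>s. s \<ge> 0 \<Longrightarrow> dist s u < d \<Longrightarrow> 0 < x s"
      using xu unfolding eventually_at by (metis atLeast_iff)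
    have "u + d \<le> Inf S"
    proof (rule cInf_greatest[OF S(1)])
      fix s assume s: "s \<in> S"
      then have "u \<le> s" using cInf_lower[OF s S(2)] by (simp add: u_def)
      then show "u + d \<le> s" using d(2)[of s] s by (force simp: S_def dist_real_def)
    qed
    then show False using d by (simp add: u_def)
  qed
  show ?thesis
  proof (rule that[of x'])
    fix t :: real assume t: "t \<ge> 0"
    show "R + v0 R * t \<le> x t" "v0 R \<le> x' t"
      using lower[OF t] v_le[OF t] pos by auto
    show "(x has_real_derivative x' t) (at t within {0..})"
      "(x' has_real_derivative - (lam * initial_mass \<rho>0 R) / x t) (at t within {0..})"
      using D[OF t] pos by (auto simp: k_def)
  qed (rule x'0)
qed

text \<open>Multiplying the equation by twice the speed turns both sides into time derivatives, of
  the squared speed and of \<open>A_fun lam \<rho>0 R * ln (x t)\<close>; here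
  \<open>lam < 0\<close> replaces \<open>-lam\<close> by the absolute value. The initial value of
  the conserved difference is \<open>C_fun lam \<rho>0 v0 R\<close>. The positive root is the right
  one because the speed is at least \<open>v0 R\<close>.\<close>

lemma characteristic_curve_energy:
  assumes cc: "characteristic_curve lam \<rho>0 v0 R x"
    and lam: "lam < 0" and m: "initial_mass \<rho>0 R \<ge> 0" and R: "R > 0" and v: "v0 R > 0"
    and t: "t \<ge> 0"
  shows "R + v0 R * t \<le> x t"
    and "(x has_real_derivative sqrt (C_fun lam \<rho>0 v0 R + A_fun lam \<rho>0 R * ln (x t))) (at t within {0..})"
proof -
  have k: "lam * initial_mass \<rho>0 R \<le> 0"
    using lam m by (simp add: mult_nonpos_nonneg)
  obtain x' where x'0: "x' 0 = v0 R" and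
    lower: "\<And>t. t \<ge> 0 \<Longrightarrow> R + v0 R * t \<le> x t" and
    vle: "\<And>t. t \<ge> 0 \<Longrightarrow> v0 R \<le> x' t" and
    D: "\<And>t. t \<ge> 0 \<Longrightarrow> (x has_real_derivative x' t) (at t within {0..})"
    "\<And>t. t \<ge> 0 \<Longrightarrow> (x' has_real_derivative - (lam * initial_mass \<rho>0 R) / x t) (at t within {0..})"
    using characteristic_curve_lower_bound[OF cc k R v] by blast
  have x0: "x 0 = R" using cc unfolding characteristic_curve_def by blast
  have pos: "x s > 0" if "s \<ge> 0" for s
    using lower[OF that] R v that by (smt (verit) mult_nonneg_nonneg)
  define E where "E s = (x' s)\<^sup>2 - A_fun lam \<rho>0 R * ln (x s)" for s
  have "(E has_real_derivative 0) (at s within {0..})" if "s \<ge> 0" for s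
    unfolding E_def using pos[OF that] lam
    by (auto intro!: derivative_eq_intros D that simp: A_fun_def field_simps)
  then have "\<exists>c. \<forall>s\<in>{0..}. E s = c"
    by (intro has_field_derivative_zero_constant) auto
  then have "E t = E 0" using t by (metis atLeast_iff order_refl)
  then have "(x' t)\<^sup>2 = C_fun lam \<rho>0 v0 R + A_fun lam \<rho>0 R * ln (x t)"
    unfolding E_def by (simp add: C_fun_def x'0 x0)
  then have "x' t = sqrt (C_fun lam \<rho>0 v0 R + A_fun lam \<rho>0 R * ln (x t))"
    using vle[OF t] v by (metis less_eq_real_def order_trans real_sqrt_unique)
  then show "R + v0 R * t \<le> x t"
    "(x has_real_derivative sqrt (C_fun lam \<rho>0 v0 R + A_fun lam \<rho>0 R * ln (x t))) (at t within {0..})"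
    using D(1)[OF t] lower[OF t] by auto
qed

section \<open>Differentiating an implicitly defined upper limit of integration\<close>

text \<open>For each fixed \<open>r\<close> the mean value theorem in the second argument gives an
  intermediate point \<open>z r\<close>. It is squeezed to \<open>x0\<close> by \<open>g r\<close>,
  and joint continuity of \<open>f\<close> yields the limit. The product form avoids a division by
  \<open>g r - x0\<close>, which may vanish.\<close>

lemma parametric_mean_value:
  fixes F f :: "real \<Rightarrow> real \<Rightarrow> real"
  assumes U: "open U" "R \<in> U" and c: "x0 > c"
    and D: "\<And>r y. r \<in> U \<Longrightarrow> y > c \<Longrightarrow> (F r has_real_derivative f r y) (at y)"
    and cont: "continuous_on (U \<times> {c<..}) (\<lambda>(r, y). f r y)"
    and g: "(g \<longlongrightarrow> x0) (at R)"
  obtains q where "(q \<longlongrightarrow> f R x0) (at R)"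
    and "\<forall>\<^sub>F r in at R. F r (g r) - F r x0 = q r * (g r - x0)"
proof -
  have ev: "\<forall>\<^sub>F r in at R. r \<in> U \<and> g r > c"
    using eventually_at_in_open'[OF U] order_tendstoD(1)[OF g c] by (rule eventually_conj)
  have "\<exists>z. \<bar>z - x0\<bar> \<le> \<bar>g r - x0\<bar> \<and> z > c \<and> F r (g r) - F r x0 = f r z * (g r - x0)"
    if r: "r \<in> U" "g r > c" for r
  proof -
    have Dr: "\<And>y. y > c \<Longrightarrow> (F r has_real_derivative f r y) (at y)" using D r by blast
    consider "g r = x0" | "g r < x0" | "g r > x0" by linarith
    then show ?thesis
    proof cases
      case 1
      then show ?thesis using c by auto
    next
      case 2
      obtain z where "g r < z" "z < x0" "F r x0 - F r (g r) = (x0 - g r) * f r z"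
        using MVT2[OF 2, of "F r" "f r"] Dr r by (meson less_le_trans)
      then show ?thesis using r by (intro exI[of _ z]) (auto simp: algebra_simps)
    next
      case 3
      obtain z where "x0 < z" "z < g r" "F r (g r) - F r x0 = (g r - x0) * f r z"
        using MVT2[OF 3, of "F r" "f r"] Dr c by (meson less_le_trans)
      then show ?thesis using c by (intro exI[of _ z]) (auto simp: algebra_simps)
    qed
  qed
  then obtain z where z: "\<And>r. r \<in> U \<Longrightarrow> g r > c \<Longrightarrow>
      \<bar>z r - x0\<bar> \<le> \<bar>g r - x0\<bar> \<and> z r > c \<and> F r (g r) - F r x0 = f r (z r) * (g r - x0)"
    by metis
  have "((\<lambda>r. z r - x0) \<longlongrightarrow> 0) (at R)"
  proof (rule Lim_null_comparison)
    show "\<forall>\<^sub>F r in at R. norm (z r - x0) \<le> \<bar>g r - x0\<bar>"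
      using ev by eventually_elim (use z in auto)
    show "((\<lambda>r. \<bar>g r - x0\<bar>) \<longlongrightarrow> 0) (at R)"
      using g by (auto intro!: tendsto_eq_intros)
  qed
  then have "(z \<longlongrightarrow> x0) (at R)" by (simp add: LIM_zero_iff)
  then have "((\<lambda>r. (r, z r)) \<longlongrightarrow> (R, x0)) (at R)"
    by (intro tendsto_intros)
  moreover have "\<forall>\<^sub>F r in at R. (r, z r) \<in> U \<times> {c<..}"
    using ev by eventually_elim (use z in auto)
  ultimately have "((\<lambda>r. (\<lambda>(r, y). f r y) (r, z r)) \<longlongrightarrow> (\<lambda>(r, y). f r y) (R, x0)) (at R)"
    using U c by (intro continuous_on_tendsto_compose[OF cont]) auto
  then have "((\<lambda>r. f r (z r)) \<longlongrightarrow> f R x0) (at R)" by simp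
  moreover have "\<forall>\<^sub>F r in at R. F r (g r) - F r x0 = f r (z r) * (g r - x0)"
    using ev by eventually_elim (use z in auto)
  ultimately show ?thesis by (rule that[of "\<lambda>r. f r (z r)"])
qed

text \<open>Formally, differentiating the identity \<open>eq\<close> gives the formula: the upper
  limit contributes \<open>f R (g R)\<close> times the unknown derivative, the lower limit
  \<open>- f R R\<close>, and the parameter the integral of \<open>fr R\<close>. Since
  \<open>g\<close> is not known to be differentiable or even continuous, continuity is proved first,
  from strict monotonicity of the integral in its upper limit, and then the difference quotient of
  \<open>g\<close> is computed.\<close>

lemma implicit_upper_limit_derivative:
  fixes f fr :: "real \<Rightarrow> real \<Rightarrow> real" and g :: "real \<Rightarrow> real"
  assumes U: "open U" "convex U" "R \<in> U" and Uc: "\<And>r. r \<in> U \<Longrightarrow> c < r"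
    and g: "\<And>r. r \<in> U \<Longrightarrow> r \<le> g r"
    and pos: "\<And>r y. r \<in> U \<Longrightarrow> c \<le> y \<Longrightarrow> 0 < f r y"
    and cf: "continuous_on (U \<times> {c..}) (\<lambda>(r, y). f r y)"
    and fr: "\<And>r y. r \<in> U \<Longrightarrow> c \<le> y \<Longrightarrow> ((\<lambda>r. f r y) has_real_derivative fr r y) (at r)"
    and cfr: "continuous_on (U \<times> {c..}) (\<lambda>(r, y). fr r y)"
    and eq: "\<And>r. r \<in> U \<Longrightarrow> integral {r..g r} (f r) = t"
  shows "(g has_real_derivative (f R R - integral {R..g R} (fr R)) / f R (g R)) (at R)"
proof -
  \<comment> \<open>the base point \<open>c < R\<close> separates the two roles of \<open>r\<close> as lower limit and as parameter\<close>
  define F where "F r x = integral {c..x} (f r)" for r x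
  have slice: "continuous_on {c..x} (h r)"
    if "r \<in> U" "continuous_on (U \<times> {c..}) (\<lambda>(r, y). h r y)" for r x and h :: "real \<Rightarrow> real \<Rightarrow> real"
  proof -
    have "continuous_on {c..x} (\<lambda>y. (\<lambda>(r, y). h r y) (r, y))"
      by (rule continuous_on_compose2[OF that(2)]) (use that(1) in \<open>auto intro!: continuous_intros\<close>)
    then show ?thesis by simp
  qed
  have Fx: "(F r has_real_derivative f r y) (at y)" if "r \<in> U" "y > c" for r y
  proof -
    have "((\<lambda>u. integral {c..u} (f r)) has_real_derivative f r y) (at y within {c..y+1})"
      by (rule integral_has_real_derivative[OF slice[OF that(1) cf]]) (use that in auto)
    moreover have "at y within {c..y+1} = at y"
      using that by (intro at_within_interior) auto
    ultimately show ?thesis unfolding F_def by simp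
  qed
  have FR: "((\<lambda>r. F r x) has_real_derivative integral {c..x} (fr R)) (at R)" for x
  proof -
    have "((\<lambda>r. integral (cbox c x) (f r)) has_real_derivative integral (cbox c x) (fr R)) (at R within U)"
    proof (rule leibniz_rule_field_derivative)
      fix r y assume "r \<in> U" "y \<in> cbox c x"
      then show "((\<lambda>r. f r y) has_real_derivative fr r y) (at r within U)"
        using fr[of r y] by (auto intro: has_field_derivative_at_within)
    next
      fix r assume "r \<in> U"
      then show "f r integrable_on cbox c x"
        using slice[OF _ cf] by (auto intro: integrable_continuous_real)
    next
      show "continuous_on (U \<times> cbox c x) (\<lambda>(r, y). fr r y)"
        by (rule continuous_on_subset[OF cfr]) auto
      show "R \<in> U" "convex U" by (rule U)+
    qed
    then show ?thesis
      unfolding F_def by (simp add: at_within_open[OF U(3,1)])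
  qed
  have mono: "F r x < F r y" if "r \<in> U" "c < x" "x < y" for r x y
  proof (rule DERIV_pos_imp_increasing[OF that(3)])
    fix u assume "x \<le> u" "u \<le> y"
    then show "\<exists>l. (F r has_real_derivative l) (at u) \<and> 0 < l"
      using Fx[of r u] pos[of r u] that by auto
  qed
  have eqF: "F r (g r) = F r r + t" if "r \<in> U" for r
  proof -
    have "integral {c..r} (f r) + integral {r..g r} (f r) = integral {c..g r} (f r)"
      by (rule Henstock_Kurzweil_Integration.integral_combine)
         (use that Uc[OF that] g[OF that] slice[OF that cf] in \<open>auto intro: integrable_continuous_real\<close>)
    then show ?thesis using eq[OF that] by (simp add: F_def)
  qed
  define x0 where "x0 = g R"
  have Rc: "c < R" and x0: "R \<le> x0" "c < x0" using Uc[OF U(3)] g[OF U(3)] by (auto simp: x0_def)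
  have cf': "continuous_on (U \<times> {c<..}) (\<lambda>(r, y). f r y)"
    by (rule continuous_on_subset[OF cf]) auto
  have evU: "\<forall>\<^sub>F r in at R. r \<in> U"
    using eventually_at_in_open'[OF U(1,3)] .
  have FRt: "((\<lambda>r. F r x) \<longlongrightarrow> F R x) (at R)" for x
    using DERIV_isCont[OF FR[of x]] by (simp add: isCont_def)
  \<comment> \<open>On the diagonal both arguments of \<open>F\<close> move; \<open>q2\<close>
    isolates the contribution of the upper limit, with \<open>g\<close> taken as the
    identity.\<close>
  obtain q2 where q2: "(q2 \<longlongrightarrow> f R R) (at R)"
    "\<forall>\<^sub>F r in at R. F r r - F r R = q2 r * (r - R)"
    by (rule parametric_mean_value[OF U(1,3) Rc Fx cf' tendsto_ident_at]) auto
  have lim_diag: "((\<lambda>r. F r r + t) \<longlongrightarrow> F R x0) (at R)"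
  proof -
    have "((\<lambda>r. F r R + q2 r * (r - R) + t) \<longlongrightarrow> F R R + f R R * (R - R) + t) (at R)"
      by (intro tendsto_intros FRt q2)
    then have "((\<lambda>r. F r r + t) \<longlongrightarrow> F R R + f R R * (R - R) + t) (at R)"
    proof (rule Lim_transform_eventually)
      show "\<forall>\<^sub>F r in at R. F r R + q2 r * (r - R) + t = F r r + t"
        using q2(2) by eventually_elim simp
    qed
    then show ?thesis using eqF[OF U(3)] by (simp add: x0_def)
  qed
  have g_lim: "(g \<longlongrightarrow> x0) (at R)"
  proof (rule order_tendstoI)
    fix a assume a: "x0 < a"
    have "F R x0 < F R a" using mono[OF U(3) x0(2) a] .
    \<comment> \<open>The level \<open>m\<close> separates \<open>F r (g r)\<close>, which is
      \<open>F r r + t\<close> and tends to \<open>F R x0\<close>, from \<open>F r a\<close>, which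
      tends to \<open>F R a\<close>. For \<open>r\<close> near \<open>R\<close> strict monotonicity
      turns this order of values into \<open>g r < a\<close>.\<close>
    then obtain m where m: "F R x0 < m" "m < F R a" using dense by blast
    have "\<forall>\<^sub>F r in at R. F r r + t < m" "\<forall>\<^sub>F r in at R. m < F r a"
      using order_tendstoD(2)[OF lim_diag m(1)] order_tendstoD(1)[OF FRt m(2)] by auto
    with evU show "\<forall>\<^sub>F r in at R. g r < a"
    proof eventually_elim
      case (elim r)
      then have "F r (g r) < F r a" using eqF[of r] by simp
      then show ?case using mono[of r a "g r"] a x0 elim by (cases "a = g r") force+
    qed
  next
    fix a assume a: "a < x0"
    \<comment> \<open>The point \<open>a\<close> may lie below \<open>c\<close>; \<open>b\<close>
      lies strictly between \<open>c\<close> and \<open>x0\<close>, where strict monotonicity is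
      available.\<close>
    define b where "b = max a ((c + x0) / 2)"
    have b: "a \<le> b" "c < b" "b < x0" using a x0 by (auto simp: b_def less_max_iff_disj)
    have "F R b < F R x0" using mono[OF U(3) b(2,3)] .
    then obtain m where m: "F R b < m" "m < F R x0" using dense by blast
    have "\<forall>\<^sub>F r in at R. m < F r r + t" "\<forall>\<^sub>F r in at R. F r b < m"
      using order_tendstoD(1)[OF lim_diag m(2)] order_tendstoD(2)[OF FRt m(1)] by auto
    with evU show "\<forall>\<^sub>F r in at R. a < g r"
    proof eventually_elim
      case (elim r)
      then have "F r b < F r (g r)" using eqF[of r] by simp
      moreover have "c < g r" using g[of r] Uc[of r] elim by auto
      ultimately have "b < g r" using mono[of r "g r" b] elim by (cases "b = g r") force+
      then show ?case using b by simp
    qed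
  qed
  obtain q1 where q1: "(q1 \<longlongrightarrow> f R x0) (at R)"
    "\<forall>\<^sub>F r in at R. F r (g r) - F r x0 = q1 r * (g r - x0)"
    by (rule parametric_mean_value[OF U(1,3) x0(2) Fx cf' g_lim]) auto
  have fx0: "f R x0 > 0" using pos[OF U(3), of x0] x0 by simp
  have quot: "((\<lambda>r. (F r x - F R x) / (r - R)) \<longlongrightarrow> integral {c..x} (fr R)) (at R)" for x
    using FR[of x] by (simp add: has_field_derivative_iff)
  \<comment> \<open>Subtracting the identity \<open>eqF\<close> at \<open>R\<close> from the one at
    \<open>r\<close> and inserting \<open>q1\<close> and \<open>q2\<close> leaves an equation linear
    in \<open>g r - x0\<close>. Solving it and dividing by \<open>r - R\<close> gives this quotient,
    whose limit is known termwise.\<close>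
  have "((\<lambda>r. (q2 r + (F r R - F R R) / (r - R) - (F r x0 - F R x0) / (r - R)) / q1 r) \<longlongrightarrow>
      (f R R + integral {c..R} (fr R) - integral {c..x0} (fr R)) / f R x0) (at R)"
    using fx0 by (intro tendsto_intros q1 q2 quot) auto
  moreover have "\<forall>\<^sub>F r in at R. (q2 r + (F r R - F R R) / (r - R) - (F r x0 - F R x0) / (r - R)) / q1 r
      = (g r - g R) / (r - R)"
  proof -
    have "\<forall>\<^sub>F r in at R. q1 r > 0" using order_tendstoD(1)[OF q1(1) fx0] .
    moreover have "\<forall>\<^sub>F r in at R. r \<noteq> R" by (simp add: eventually_at_filter)
    ultimately show ?thesis using q1(2) q2(2) evU
    proof eventually_elim
      case (elim r)
      have "q1 r * (g r - x0) = q2 r * (r - R) + (F r R - F R R) - (F r x0 - F R x0)"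
        using elim(3,4) eqF[OF elim(5)] eqF[OF U(3)] by (simp add: x0_def)
      then have "g r - x0 = (q2 r * (r - R) + (F r R - F R R) - (F r x0 - F R x0)) / q1 r"
        using elim(1) by (simp add: field_simps)
      then show ?case
        using elim(1,2) by (simp add: x0_def[symmetric] diff_divide_distrib add_divide_distrib mult.commute)
    qed
  qed
  ultimately have "((\<lambda>r. (g r - g R) / (r - R)) \<longlongrightarrow>
      (f R R + integral {c..R} (fr R) - integral {c..x0} (fr R)) / f R x0) (at R)"
    by (rule Lim_transform_eventually)
  \<comment> \<open>The part of the integral below \<open>R\<close> cancels, so the auxiliary point
    \<open>c\<close> disappears from the result.\<close>
  moreover have "integral {c..x0} (fr R) = integral {c..R} (fr R) + integral {R..x0} (fr R)"
    by (rule Henstock_Kurzweil_Integration.integral_combine[symmetric])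
       (use Rc x0 slice[OF U(3) cfr] in \<open>auto intro: integrable_continuous_real\<close>)
  ultimately show ?thesis
    by (simp add: has_field_derivative_iff x0_def)
qed

section \<open>Zeros of the function governing the radial derivative\<close>

text \<open>Here \<open>a\<close>, \<open>b\<close>, \<open>p\<close>, \<open>q\<close> stand for C,
  A and their derivatives at \<open>R\<close>, and \<open>v\<close> for the initial speed. As
  \<open>b\<close> is nonnegative, the radicand stays at least \<open>v\<^sup>2\<close> beyond
  \<open>R\<close>, so \<open>G\<close> is continuous and starts at the positive value
  \<open>1 / v\<close>. By the intermediate value theorem a zero exists as soon as \<open>G\<close>
  is nonpositive somewhere.\<close>

lemma ex_zero_breakdown_integral_iff:
  fixes a b p q R v :: real
  assumes b: "0 \<le> b" and q: "0 \<le> q" and R: "0 < R" and v: "0 < v" and vR: "a + b * ln R = v\<^sup>2"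
  defines "h \<equiv> \<lambda>y. (p + q * ln y) / (a + b * ln y) powr (3 / 2)"
  defines "G \<equiv> \<lambda>y. 1 / v + 1 / 2 * integral {R..y} h"
  shows "(\<exists>y>R. G y = 0) \<longleftrightarrow> p + q * ln R < 0 \<and> (q = 0 \<or> q > 0 \<and> G (exp (- p / q)) \<le> 0)"
proof -
  have W: "v\<^sup>2 \<le> a + b * ln y" if "R \<le> y" for y
    using mult_left_mono[of "ln R" "ln y" b] that R b vR by simp
  have Wpos: "0 < a + b * ln y" if "R \<le> y" for y
    using W[OF that] v by (smt (verit) zero_less_power)
  have den: "0 < (a + b * ln y) powr (3 / 2)" if "R \<le> y" for y
    using Wpos[OF that] by simp
  have "continuous_on {R..} h"
    unfolding h_def using R Wpos by (intro continuous_intros ballI) (force dest: Wpos)+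
  then have ch: "continuous_on {x..y} h" if "R \<le> x" for x y
    by (rule continuous_on_subset) (use that in auto)
  have int: "h integrable_on {x..y}" if "R \<le> x" for x y
    using ch[OF that] by (rule integrable_continuous_real)
  have cG: "continuous_on {R..y} G" for y
    unfolding G_def by (intro continuous_intros indefinite_integral_continuous_1 int) simp
  have GR: "G R = 1 / v" by (simp add: G_def)
  have Gdiff: "G y = G x + 1 / 2 * integral {x..y} h" if "R \<le> x" "x \<le> y" for x y
    using Henstock_Kurzweil_Integration.integral_combine[OF that int[OF order_refl]]
    by (simp add: G_def)
  have zero: "\<exists>y>R. G y = 0" if x: "R \<le> x" and Gx: "G x \<le> 0" for x
  proof -
    obtain y where "R \<le> y" "y \<le> x" "G y = 0"
      using IVT2'[OF Gx _ x cG] GR v by auto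
    moreover have "y \<noteq> R" using calculation GR v by auto
    ultimately show ?thesis by (intro exI[of _ y]) auto
  qed
  have mono: "p + q * ln x \<le> p + q * ln y" if "0 < x" "x \<le> y" for x y
    using that q by (simp add: mult_left_mono)
  consider "p + q * ln R \<ge> 0" | "p + q * ln R < 0" "q = 0" | "p + q * ln R < 0" "q > 0"
    using q by linarith
  then show ?thesis
  proof cases
    case 1
    have "G y > 0" if "y > R" for y
    proof -
      have "integral {R..y} h \<ge> 0"
      proof (rule integral_nonneg[OF int[OF order_refl]])
        fix z assume "z \<in> {R..y}"
        then show "0 \<le> h z" unfolding h_def using 1 mono[OF R, of z] den[of z] by simp
      qed
      then show ?thesis using v by (simp add: G_def add_pos_nonneg)
    qed
    then show ?thesis using 1 by force
  next
    case 2
    \<comment> \<open>\<open>K * y\<close> will dominate the denominator of \<open>h\<close>. With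
      \<open>u = (y / R) powr (2 / 3)\<close>, \<open>ln (y / R)\<close> is at most
      \<open>3 / 2 * u\<close>, which explains the summand \<open>3 / 2 * b\<close>; the outer power
      \<open>3 / 2\<close> turns \<open>u\<close> back into \<open>y / R\<close>.\<close>
    define K where "K = (v\<^sup>2 + 3 / 2 * b) powr (3 / 2) / R"
    have "v\<^sup>2 + 3 / 2 * b > 0" using v b by (simp add: add_pos_nonneg)
    then have K: "K > 0" using R unfolding K_def by simp
    \<comment> \<open>the logarithm is dominated by the power \<open>2/3\<close>, so that \<open>h\<close> is at most a negative multiple of \<open>1/y\<close>\<close>
    have hle: "h y \<le> p / K * (1 / y)" if y: "R \<le> y" for y
    proof -
      define u where "u = (y / R) powr (2 / 3)"
      have u1: "u \<ge> 1" unfolding u_def using y R by (intro ge_one_powr_ge_zero) auto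
      have "ln u = 2 / 3 * ln (y / R)" unfolding u_def using y R by (simp add: ln_powr)
      then have "ln y - ln R \<le> 3 / 2 * u"
        using ln_le_minus_one[of u] u1 y R by (simp add: ln_div)
      then have "b * (ln y - ln R) \<le> b * (3 / 2 * u)" using b by (rule mult_left_mono)
      moreover have "v\<^sup>2 \<le> v\<^sup>2 * u" using u1 by (simp add: mult_le_cancel_left1)
      ultimately have "a + b * ln y \<le> (v\<^sup>2 + 3 / 2 * b) * u"
        using vR by (simp add: algebra_simps)
      then have "(a + b * ln y) powr (3 / 2) \<le> ((v\<^sup>2 + 3 / 2 * b) * u) powr (3 / 2)"
        using Wpos[OF y] by (intro powr_mono2) auto
      also have "\<dots> = (v\<^sup>2 + 3 / 2 * b) powr (3 / 2) * (y / R)"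
        using u1 b y R by (simp add: powr_mult u_def powr_powr)
      finally have "(a + b * ln y) powr (3 / 2) \<le> K * y" by (simp add: K_def)
      then have "p / (a + b * ln y) powr (3 / 2) \<le> p / (K * y)"
        using 2 den[OF y] K y R by (intro divide_left_mono_neg mult_pos_pos) auto
      then show ?thesis using 2 by (simp add: h_def)
    qed
    \<comment> \<open>The point is chosen so that \<open>p / K * ln (x / R) = - 2 / v\<close>; half
      of this cancels the starting value \<open>1 / v\<close>. As \<open>p\<close> is negative,
      \<open>x\<close> is not below \<open>R\<close>.\<close>
    define x where "x = R * exp (- (2 * K) / (p * v))"
    have x: "R \<le> x" using R 2 K v by (simp add: x_def divide_nonneg_neg mult_neg_pos)
    have "((\<lambda>y. p / K * (1 / y)) has_integral p / K * ln x - p / K * ln R) {R..x}"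
      using x R K by (intro fundamental_theorem_of_calculus)
        (auto simp: has_real_derivative_iff_has_vector_derivative[symmetric] intro!: derivative_eq_intros)
    then have "integral {R..x} h \<le> p / K * ln x - p / K * ln R"
      using int[OF order_refl, of x] hle by (intro has_integral_le[OF integrable_integral]) auto
    also have "\<dots> = - 2 / v"
      using R 2 K v by (simp add: x_def ln_mult field_simps)
    finally have "G x \<le> 0" using v by (simp add: G_def)
    then show ?thesis using zero[OF x] 2 by auto
  next
    case 3
    define z where "z = exp (- p / q)"
    have z0: "0 < z" by (simp add: z_def)
    have lnz: "p + q * ln z = 0" using 3 by (simp add: z_def)
    have Rz: "R < z"
      using mono[of z R] 3 lnz z0 by (cases "z \<le> R") auto
    have min: "G z \<le> G y" if y: "R < y" for y
    proof (cases "y \<le> z")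
      case True
      have "integral {y..z} h \<le> integral {y..z} (\<lambda>_. 0)"
      proof (rule integral_le[OF int])
        fix s assume s: "s \<in> {y..z}"
        then show "h s \<le> 0"
          unfolding h_def using mono[of s z] lnz den[of s] y R by (simp add: divide_nonpos_pos)
      qed (use y in auto)
      then show ?thesis using Gdiff[of y z] y True by simp
    next
      case False
      have "integral {z..y} h \<ge> 0"
      proof (rule integral_nonneg[OF int])
        fix s assume s: "s \<in> {z..y}"
        then show "0 \<le> h s"
          unfolding h_def using mono[of z s] lnz den[of s] z0 Rz by simp
      qed (use Rz in auto)
      then show ?thesis using Gdiff[of z y] Rz False by simp
    qed
    have "(\<exists>y>R. G y = 0) \<longleftrightarrow> G z \<le> 0"
      using min zero[of z] Rz by force
    then show ?thesis using 3 by (simp add: z_def)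
  qed
qed

section \<open>Derivatives of the data functions\<close>

lemma A_fun_nonneg:
  assumes "admissible_data \<rho>0 v0"
  shows "0 \<le> A_fun lam \<rho>0 r"
  using initial_mass_nonneg[OF assms] by (simp add: A_fun_def)

lemma A_fun_has_derivative:
  assumes "admissible_data \<rho>0 v0" "r > 0"
  shows "(A_fun lam \<rho>0 has_real_derivative 2 * \<bar>lam\<bar> * (\<rho>0 r * r)) (at r)"
  unfolding A_fun_def by (intro DERIV_cmult initial_mass_has_derivative[OF assms])

lemma v0_has_continuous_derivative:
  assumes "admissible_data \<rho>0 v0"
  shows "r > 0 \<Longrightarrow> (v0 has_real_derivative deriv v0 r) (at r)"
    and "continuous_on {0<..} (deriv v0)"
proof -
  obtain D where D: "\<And>r. r > 0 \<Longrightarrow> (v0 has_real_derivative D r) (at r)" "continuous_on {0<..} D"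
    using assms unfolding admissible_data_def C1_differentiable_on_def
    by (auto simp: has_real_derivative_iff_has_vector_derivative)
  have "deriv v0 r = D r" if "r > 0" for r using D(1)[OF that] by (rule DERIV_imp_deriv)
  then show "r > 0 \<Longrightarrow> (v0 has_real_derivative deriv v0 r) (at r)"
    "continuous_on {0<..} (deriv v0)"
    using D(1) by (auto intro: continuous_on_eq[OF D(2)])
qed

lemma C_fun_has_derivative:
  assumes "admissible_data \<rho>0 v0" "r > 0"
  shows "(C_fun lam \<rho>0 v0 has_real_derivative
    2 * v0 r * deriv v0 r - 2 * \<bar>lam\<bar> * (\<rho>0 r * r) * ln r - A_fun lam \<rho>0 r / r) (at r)"
  unfolding C_fun_def using assms(2)
  by (auto intro!: derivative_eq_intros A_fun_has_derivative[OF assms]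
      v0_has_continuous_derivative[OF assms(1)] simp: field_simps)

section \<open>Travel time and its derivative in the starting radius\<close>

text \<open>Along the curve the integral grows at rate one, since the integrand is the reciprocal of
  the speed given by the energy identity. It vanishes at time 0, so it equals the elapsed
  time.\<close>

lemma characteristic_curve_time:
  assumes ad: "admissible_data \<rho>0 v0" and cc: "characteristic_curve lam \<rho>0 v0 r x"
    and lam: "lam < 0" and r: "r > 0" and v: "v0 r > 0" and t: "t \<ge> 0"
  shows "integral {r..x t} (\<lambda>y. (C_fun lam \<rho>0 v0 r + A_fun lam \<rho>0 r * ln y) powr (- 1 / 2)) = t"
proof -
  define w where "w y = C_fun lam \<rho>0 v0 r + A_fun lam \<rho>0 r * ln y" for y
  define f where "f y = w y powr (- 1 / 2)" for y
  define F where "F u = integral {r..u} f" for u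
  note curve = characteristic_curve_energy[OF cc lam initial_mass_nonneg[OF ad] r v]
  have wpos: "w y > 0" if "r \<le> y" for y
    using mult_left_mono[of "ln r" "ln y", OF _ A_fun_nonneg[OF ad, of lam r]] that r v
    by (simp add: w_def C_fun_def) (smt (verit) zero_less_power)
  have cf: "continuous_on {r..y} f" for y
    unfolding f_def w_def using r wpos[unfolded w_def]
    by (intro continuous_intros ballI) force+
  \<comment> \<open>At the starting point \<open>r\<close> only the derivative from the right is
    right, because \<open>F\<close> is zero to the left of \<open>r\<close>. This suffices for the
    chain rule, as the curve stays in \<open>{r..}\<close>.\<close>
  have dF: "(F has_real_derivative f y) (at y within {r..})" if y: "r \<le> y" for y
  proof -
    have "(F has_real_derivative f y) (at y within {r..y+1})"
      unfolding F_def by (rule integral_has_real_derivative[OF cf]) (use y in auto)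
    moreover have "at y within {r..y+1} = at y within {r..}"
      by (rule at_within_nhd[of _ "{..<y+1}"]) auto
    ultimately show ?thesis by simp
  qed
  have lower: "r \<le> x s" if "s \<ge> 0" for s
    using curve(1)[OF that] v that by (smt (verit) mult_nonneg_nonneg)
  have "((\<lambda>s. F (x s) - s) has_real_derivative 0) (at s within {0..})" if s: "s \<ge> 0" for s
  proof -
    have "(F has_real_derivative f (x s)) (at (x s) within x ` {0..})"
      by (rule DERIV_subset[OF dF]) (use lower s in auto)
    from DERIV_image_chain[OF this curve(2)[OF s]]
    have "((\<lambda>s. F (x s)) has_real_derivative f (x s) * sqrt (w (x s))) (at s within {0..})"
      by (simp add: o_def w_def)
    moreover have "f (x s) * sqrt (w (x s)) = 1"
      using wpos[OF lower[OF s]] by (simp add: f_def powr_minus powr_half_sqrt)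
    ultimately show ?thesis by (auto intro!: derivative_eq_intros)
  qed
  then have "\<exists>c. \<forall>s\<in>{0..}. F (x s) - s = c"
    by (intro has_field_derivative_zero_constant) auto
  then have "F (x t) - t = F (x 0) - 0" using t by (metis atLeast_iff order_refl)
  moreover have "x 0 = r" using cc by (simp add: characteristic_curve_def)
  ultimately show ?thesis by (simp add: F_def f_def[abs_def] w_def)
qed

text \<open>The travel time identity holds for all starting radii near \<open>R\<close> with the
  same \<open>t\<close>, so it defines \<open>X t r\<close> implicitly as an upper limit. The work
  lies in finding a neighbourhood of \<open>R\<close> and a base point below it on which the
  integrand is smooth enough.\<close>

lemma characteristic_flow_radial_derivative:
  assumes ad: "admissible_data \<rho>0 v0" and lam: "lam < 0"
    and flow: "characteristic_flow lam \<rho>0 v0 X" and R: "R > 0" and v: "v0 R > 0" and t: "t \<ge> 0"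
  defines "w \<equiv> \<lambda>y. C_fun lam \<rho>0 v0 R + A_fun lam \<rho>0 R * ln y"
  shows "((\<lambda>r. X t r) has_real_derivative sqrt (w (X t R)) *
    (1 / v0 R + 1 / 2 * integral {R..X t R}
      (\<lambda>y. (deriv (C_fun lam \<rho>0 v0) R + deriv (A_fun lam \<rho>0) R * ln y) / w y powr (3 / 2)))) (at R)"
proof -
  define A where "A = A_fun lam \<rho>0"
  define C where "C = C_fun lam \<rho>0 v0"
  define A' where "A' r = 2 * \<bar>lam\<bar> * (\<rho>0 r * r)" for r
  define C' where "C' r = 2 * v0 r * deriv v0 r - A' r * ln r - A r / r" for r
  have dA: "(A has_real_derivative A' r) (at r)" if "r > 0" for r
    unfolding A_def A'_def by (rule A_fun_has_derivative[OF ad that])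
  have dC: "(C has_real_derivative C' r) (at r)" if "r > 0" for r
    unfolding C_def C'_def A_def A'_def by (rule C_fun_has_derivative[OF ad that])
  have A0: "A r \<ge> 0" for r unfolding A_def by (rule A_fun_nonneg[OF ad])
  have c0: "continuous_on {0..} v0" "continuous_on {0..} \<rho>0"
    using ad by (simp_all add: admissible_data_def)
  have cv: "continuous_on {0<..} v0" and c\<rho>: "continuous_on {0<..} \<rho>0"
    by (rule continuous_on_subset[OF c0(1)], force) (rule continuous_on_subset[OF c0(2)], force)
  have cA: "continuous_on {0<..} A" and cC: "continuous_on {0<..} C"
    by (intro continuous_at_imp_continuous_on ballI DERIV_isCont[OF dA] DERIV_isCont[OF dC], simp)+
  have cA': "continuous_on {0<..} A'"
    unfolding A'_def by (intro continuous_intros c\<rho>)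
  have cC': "continuous_on {0<..} C'"
    unfolding C'_def
    by (intro continuous_intros cv cA cA' v0_has_continuous_derivative(2)[OF ad]) auto
  have wR: "C R + A R * ln R = (v0 R)\<^sup>2" by (simp add: C_def A_def C_fun_def)
  \<comment> \<open>The radicand is positive at \<open>y = R\<close>, hence still at some
    \<open>c < R\<close>. Since A is nonnegative, positivity at \<open>c\<close> passes to every
    larger \<open>y\<close>.\<close>
  have "isCont (\<lambda>y. C R + A R * ln y) R" using R by (intro continuous_intros) auto
  then have "((\<lambda>y. C R + A R * ln y) \<longlongrightarrow> (v0 R)\<^sup>2) (at_left R)"
    unfolding isCont_def wR by (rule tendsto_within_subset) simp
  then have "\<forall>\<^sub>F y in at_left R. 0 < C R + A R * ln y"
    by (rule order_tendstoD(1)) (use v in simp)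
  from eventually_conj[OF eventually_at_left_real[OF R] this]
  have "\<exists>c. c \<in> {0<..<R} \<and> 0 < C R + A R * ln c"
    by (rule eventually_happens'[OF trivial_limit_at_left_real])
  then obtain c where c: "0 < c" "c < R" "0 < C R + A R * ln c" by auto
  have ev: "\<forall>\<^sub>F r in nhds R. 0 < g r" if "isCont g R" "0 < g R" for g :: "real \<Rightarrow> real"
    using that unfolding isCont_def tendsto_at_iff_tendsto_nhds by (rule order_tendstoD)
  note isC = DERIV_isCont[OF dC[OF R]] DERIV_isCont[OF dA[OF R]]
    DERIV_isCont[OF v0_has_continuous_derivative(1)[OF ad R]]
  \<comment> \<open>Positive radicand at \<open>c\<close>, positive initial speed and
    \<open>c < r\<close> are open conditions satisfied at \<open>R\<close>; together they hold on a
    ball, which is also convex as the Leibniz rule requires.\<close>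
  have "\<forall>\<^sub>F r in nhds R. 0 < C r + A r * ln c"
    by (rule ev) (intro continuous_intros isC c(3))+
  moreover have "\<forall>\<^sub>F r in nhds R. 0 < v0 r"
    by (rule ev[OF isC(3) v])
  moreover have "\<forall>\<^sub>F r in nhds R. 0 < r - c"
    by (rule ev) (use c(2) in \<open>simp_all\<close>)
  ultimately have "\<forall>\<^sub>F r in nhds R. 0 < C r + A r * ln c \<and> 0 < v0 r \<and> c < r"
    by eventually_elim auto
  then obtain d where d: "d > 0" and
    near: "\<And>r. dist r R < d \<Longrightarrow> 0 < C r + A r * ln c \<and> 0 < v0 r \<and> c < r"
    unfolding eventually_nhds_metric by blast
  define U where "U = ball R d"
  have U: "open U" "convex U" "R \<in> U" using d by (auto simp: U_def)
  have near: "0 < C r + A r * ln c" "0 < v0 r" "c < r" "0 < r" if "r \<in> U" for r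
    using near[of r] that c by (auto simp: U_def dist_commute)
  have W: "0 < C r + A r * ln y" if "r \<in> U" "c \<le> y" for r y
    using near(1)[OF that(1)] mult_left_mono[of "ln c" "ln y", OF _ A0[of r]] that c by simp
  have compose: "continuous_on (U \<times> {c..}) (\<lambda>p. g (fst p))"
    if "continuous_on {0<..} g" for g :: "real \<Rightarrow> real"
    by (rule continuous_on_compose2[OF that continuous_on_fst[OF continuous_on_id]])
       (use near(4) in auto)
  have ln: "continuous_on (U \<times> {c..}) (\<lambda>p. ln (snd p))"
    using c by (intro continuous_intros) auto
  have W0: "C (fst p) + A (fst p) * ln (snd p) \<noteq> 0"
      "(C (fst p) + A (fst p) * ln (snd p)) powr (3 / 2) \<noteq> 0" if "p \<in> U \<times> {c..}" for p
    using W[of "fst p" "snd p"] that by (auto simp: mem_Times_iff)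
  have curve: "characteristic_curve lam \<rho>0 v0 r (\<lambda>t. X t r)" if "r > 0" for r
    using flow that by (simp add: characteristic_flow_def)
  have lower: "r \<le> X t r" if r: "r \<in> U" for r
  proof -
    have "r + v0 r * t \<le> X t r"
      by (rule characteristic_curve_energy(1)[OF curve lam initial_mass_nonneg[OF ad] _ _ t])
        (rule near(4,2)[OF r])+
    then show ?thesis using t near(2)[OF r] by (smt (verit) mult_nonneg_nonneg)
  qed
  define f where "f r y = (C r + A r * ln y) powr (- 1 / 2)" for r y
  define fr where "fr r y = - 1 / 2 * ((C' r + A' r * ln y) / (C r + A r * ln y) powr (3 / 2))" for r y
  have dX: "((\<lambda>r. X t r) has_real_derivative (f R R - integral {R..X t R} (fr R)) / f R (X t R)) (at R)"
    (is "(_ has_real_derivative ?D) _")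
  proof (rule implicit_upper_limit_derivative[OF U near(3)])
    fix r assume r: "r \<in> U"
    show "r \<le> X t r" by (rule lower[OF r])
    show "integral {r..X t r} (f r) = t"
      using characteristic_curve_time[OF ad curve[OF near(4)[OF r]] lam near(4)[OF r] near(2)[OF r] t]
      by (simp add: f_def[abs_def] C_def A_def)
    fix y assume y: "c \<le> y"
    show "0 < f r y" using W[OF r y] by (simp add: f_def)
    have "((\<lambda>r. C r + A r * ln y) has_real_derivative C' r + A' r * ln y) (at r)"
      using dA[OF near(4)[OF r]] dC[OF near(4)[OF r]] by (auto intro!: derivative_eq_intros)
    from DERIV_powr[OF this W[OF r y], of "\<lambda>_. - 1 / 2" 0]
    have df: "((\<lambda>r. f r y) has_real_derivative
        f r y * ((C' r + A' r * ln y) * (- 1 / 2) / (C r + A r * ln y))) (at r)"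
      by (simp add: f_def)
    have f_quot: "f r y / (C r + A r * ln y) = 1 / (C r + A r * ln y) powr (3 / 2)"
    proof -
      have "f r y / (C r + A r * ln y) = (C r + A r * ln y) powr (- 1 / 2 - 1)"
        using W[OF r y] unfolding f_def powr_diff by simp
      also have "\<dots> = 1 / (C r + A r * ln y) powr (3 / 2)"
        using powr_minus_divide[of "C r + A r * ln y" "3 / 2"] by simp
      finally show ?thesis .
    qed
    have "f r y * ((C' r + A' r * ln y) * (- 1 / 2) / (C r + A r * ln y)) =
        - 1 / 2 * (C' r + A' r * ln y) * (f r y / (C r + A r * ln y))"
      by simp
    also have "\<dots> = fr r y" unfolding f_quot fr_def by simp
    finally show "((\<lambda>r. f r y) has_real_derivative fr r y) (at r)" using df by simp
  next
    show "continuous_on (U \<times> {c..}) (\<lambda>(r, y). f r y)"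
      unfolding f_def split_beta
      by (intro continuous_intros compose cA cC ln ballI W0)
    show "continuous_on (U \<times> {c..}) (\<lambda>(r, y). fr r y)"
      unfolding fr_def split_beta
      by (intro continuous_intros compose cA cC cA' cC' ln ballI W0)
  qed
  have "0 < w (X t R)"
    using W[OF U(3), of "X t R"] lower[OF U(3)] c by (simp add: w_def C_def A_def)
  then have rate: "1 / f R (X t R) = sqrt (w (X t R))"
    by (simp add: f_def w_def C_def A_def powr_minus powr_half_sqrt inverse_eq_divide)
  \<comment> \<open>The reciprocal of the integrand at the upper limit is the current speed, which
    becomes the prefactor; the minus sign here and the \<open>- 1 / 2\<close> in \<open>fr\<close>
    combine to \<open>1 / 2\<close>.\<close>
  have D: "?D = sqrt (w (X t R)) * (f R R - integral {R..X t R} (fr R))"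
    unfolding rate[symmetric] by simp
  have fRR: "f R R = 1 / v0 R"
    using v by (simp add: f_def wR powr_minus powr_half_sqrt inverse_eq_divide)
  have int: "integral {R..X t R} (fr R) =
      - 1 / 2 * integral {R..X t R} (\<lambda>y. (C' R + A' R * ln y) / w y powr (3 / 2))"
    unfolding fr_def w_def C_def A_def by (rule integral_mult_right)
  have "deriv (C_fun lam \<rho>0 v0) R = C' R" "deriv (A_fun lam \<rho>0) R = A' R"
    using DERIV_imp_deriv[OF dC[OF R]] DERIV_imp_deriv[OF dA[OF R]] by (simp_all add: C_def A_def)
  with dX[unfolded D, unfolded fRR int] show ?thesis by simp
qed

section \<open>Breakdown times as zeros along the curve\<close>

theorem proposition1p13:
  fixes lam R :: real and \<rho>0 v0 :: "real \<Rightarrow> real" and X :: "real \<Rightarrow> real \<Rightarrow> real"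
  assumes "admissible_data \<rho>0 v0"
    and "lam < 0"
    and "characteristic_flow lam \<rho>0 v0 X"
    and "R > 0"
    and "v0 R > 0"
  shows "((\<exists>t_c>0. breakdown_at X R t_c) \<longleftrightarrow>
      deriv v0 R < A_fun lam \<rho>0 R / (2 * R * v0 R) \<and>
      (\<rho>0 R = 0 \<or>
       deriv (A_fun lam \<rho>0) R > 0 \<and>
       1 / v0 R + 1 / 2 *
         integral {R..exp (- deriv (C_fun lam \<rho>0 v0) R / deriv (A_fun lam \<rho>0) R)}
           (\<lambda>y. (deriv (C_fun lam \<rho>0 v0) R + deriv (A_fun lam \<rho>0) R * ln y) /
                 (C_fun lam \<rho>0 v0 R + A_fun lam \<rho>0 R * ln y) powr (3 / 2)) \<le> 0))
    \<and> (deriv (A_fun lam \<rho>0) R > 0 \<longrightarrow>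
        (deriv v0 R < A_fun lam \<rho>0 R / (2 * R * v0 R) \<longleftrightarrow>
         exp (- deriv (C_fun lam \<rho>0 v0) R / deriv (A_fun lam \<rho>0) R) > R))
    \<and> (\<rho>0 R = 0 \<longleftrightarrow> deriv (A_fun lam \<rho>0) R = 0)"
proof -
  note ad = assms(1) and lam = assms(2) and R = assms(4) and v = assms(5)
  define a b p q where "a = C_fun lam \<rho>0 v0 R" and "b = A_fun lam \<rho>0 R"
    and "p = deriv (C_fun lam \<rho>0 v0) R" and "q = deriv (A_fun lam \<rho>0) R"
  define G where "G y = 1 / v0 R + 1 / 2 *
    integral {R..y} (\<lambda>y. (p + q * ln y) / (a + b * ln y) powr (3 / 2))" for y
  have qeq: "q = 2 * \<bar>lam\<bar> * (\<rho>0 R * R)"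
    unfolding q_def by (rule DERIV_imp_deriv[OF A_fun_has_derivative[OF ad R]])
  have peq: "p = 2 * v0 R * deriv v0 R - q * ln R - b / R"
    unfolding p_def b_def qeq by (rule DERIV_imp_deriv[OF C_fun_has_derivative[OF ad R]])
  have "\<rho>0 R \<ge> 0" using ad R by (simp add: admissible_data_def)
  then have q0: "q \<ge> 0" using R by (simp add: qeq)
  have \<rho>q: "\<rho>0 R = 0 \<longleftrightarrow> q = 0" using lam R by (simp add: qeq)
  have b0: "b \<ge> 0" unfolding b_def by (rule A_fun_nonneg[OF ad])
  have aR: "a + b * ln R = (v0 R)\<^sup>2" by (simp add: a_def b_def C_fun_def)
  \<comment> \<open>The logarithmic terms cancel in \<open>p + q * ln R\<close>, leaving
    \<open>2 * v0 R * deriv v0 R - b / R\<close>.\<close>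
  have slope: "deriv v0 R < b / (2 * R * v0 R) \<longleftrightarrow> p + q * ln R < 0"
    using R v by (simp add: peq field_simps)
  have cc: "characteristic_curve lam \<rho>0 v0 R (\<lambda>t. X t R)"
    using assms(3) R by (simp add: characteristic_flow_def)
  note curve = characteristic_curve_energy[OF cc lam initial_mass_nonneg[OF ad] R v]
  have Xgt: "R < X t R" if "t > 0" for t
    using curve(1)[of t] that v by (smt (verit) mult_pos_pos)
  have X0: "X 0 R = R" using cc by (simp add: characteristic_curve_def)
  \<comment> \<open>The curve never reaches the origin, so only a vanishing radial derivative can
    cause breakdown; the positive speed factor cannot produce the zero.\<close>
  have bd: "breakdown_at X R t \<longleftrightarrow> G (X t R) = 0" if t: "t > 0" for t
  proof -
    have pos: "0 < X s R" if "s \<ge> 0" for s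
      using Xgt[of s] X0 R that by (cases "s = 0") auto
    have "0 < (v0 R)\<^sup>2" using v by simp
    also have "\<dots> \<le> a + b * ln (X t R)"
      unfolding aR[symmetric] using b0 Xgt[OF t] R by (simp add: mult_left_mono)
    finally have w: "sqrt (a + b * ln (X t R)) \<noteq> 0" by simp
    have D: "((\<lambda>r. X t r) has_real_derivative sqrt (a + b * ln (X t R)) * G (X t R)) (at R)"
      using characteristic_flow_radial_derivative[OF ad lam assms(3) R v, of t] t
      by (simp add: G_def a_def b_def p_def q_def)
    have "((\<lambda>r. X t r) has_real_derivative 0) (at R) \<longleftrightarrow> sqrt (a + b * ln (X t R)) * G (X t R) = 0"
      using D DERIV_unique[OF D] by metis
    then show ?thesis
      unfolding breakdown_at_def using pos t w less_imp_neq[OF pos[of t]] by auto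
  qed
  \<comment> \<open>By the linear lower bound the curve has reached \<open>y\<close> by time
    \<open>T\<close>. With \<open>Xgt\<close> this lets a search over positive times be replaced by
    one over positions beyond \<open>R\<close>.\<close>
  have onto: "\<exists>t>0. X t R = y" if y: "R < y" for y
  proof -
    define T where "T = (y - R) / v0 R"
    have T: "T \<ge> 0" "y \<le> X T R" using y v curve(1)[of T] by (auto simp: T_def)
    have "continuous_on {0..T} (\<lambda>t. X t R)"
      using curve(2) by (intro DERIV_continuous_on[OF DERIV_subset]) auto
    then obtain t where "0 \<le> t" "X t R = y"
      using IVT'[of "\<lambda>t. X t R" 0 y T] T y X0 by auto
    moreover have "t \<noteq> 0" using calculation X0 y by auto
    ultimately show ?thesis by (intro exI[of _ t]) auto
  qed
  have "(\<exists>t>0. breakdown_at X R t) \<longleftrightarrow> (\<exists>y>R. G y = 0)"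
    using bd onto Xgt by metis
  also have "\<dots> \<longleftrightarrow> p + q * ln R < 0 \<and> (q = 0 \<or> q > 0 \<and> G (exp (- p / q)) \<le> 0)"
    unfolding G_def by (rule ex_zero_breakdown_integral_iff[OF b0 q0 R v aR])
  finally have main: "(\<exists>t>0. breakdown_at X R t) \<longleftrightarrow>
      p + q * ln R < 0 \<and> (q = 0 \<or> q > 0 \<and> G (exp (- p / q)) \<le> 0)" .
  have "R < exp (- p / q) \<longleftrightarrow> p + q * ln R < 0" if "q > 0"
  proof -
    have "R < exp (- p / q) \<longleftrightarrow> ln R < - p / q"
      using R by (metis exp_less_cancel_iff exp_ln)
    then show ?thesis using that by (auto simp: field_simps)
  qed
  with main slope \<rho>q show ?thesis
    unfolding G_def a_def b_def p_def q_def by blast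
qed

end
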